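(* Let $X$ and $Y$ be perfect zero-dimensional Polish spaces and let $A$ be a nonempty $G_\delta$ subset of $X\times Y$ which is locally with open projections (l.p.o.). Then there exist nonempty almost-open sets $F$ and $G$, one contained in $X$ and the other contained in $Y$, and a continuous open surjection from $F$ onto $G$ whose graph is contained in $A$ (if $F\subseteq X$ and $G\subseteq Y$) or in $\{(y,x)\in Y\times X : (x,y)\in A\}$ (if $F\subseteq Y$ and $G\subseteq X$).
   Context: A $G_\delta$ subset of a topological space is called almost-open if it is contained in the interior of its closure (equivalently, it is dense in some open set). If $X$ and $Y$ are topological spaces, a set $A\subseteq X\times Y$ is called locally with open projections (l.p.o.) if for every open set $U\subseteq X\times Y$, both projections of $A\cap U$ (onto $X$ and onto $Y$) are open. *)

theory Defs
  imports "HOL-Analysis.Analysis"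
begin

definition polish_topology :: "'a topology \<Rightarrow> bool" where
  "polish_topology X \<longleftrightarrow> completely_metrizable_space X \<and> separable_space X"

definition perfect_topology :: "'a topology \<Rightarrow> bool" where
  "perfect_topology X \<longleftrightarrow> X derived_set_of topspace X = topspace X"

text \<open>Zero-dimensional in the usual sense of descriptive set theory: the clopen sets form a base.
  The library lemma \<open>dimension_le_0_neighbourhood_base_of_clopen\<close> relates this to small inductive
  dimension.\<close>

definition zero_dimensional_topology :: "'a topology \<Rightarrow> bool" where
  "zero_dimensional_topology X \<longleftrightarrow>
     neighbourhood_base_of (\<lambda>U. closedin X U \<and> openin X U) X"

definition almost_open_in :: "'a topology \<Rightarrow> 'a set \<Rightarrow> bool" where
  "almost_open_in X S \<longleftrightarrow> gdelta_in X S \<and> S \<subseteq> X interior_of (X closure_of S)"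

definition locally_open_projections :: "'a topology \<Rightarrow> 'b topology \<Rightarrow> ('a \<times> 'b) set \<Rightarrow> bool" where
  "locally_open_projections X Y A \<longleftrightarrow>
     (\<forall>U. openin (prod_topology X Y) U \<longrightarrow>
          openin X (fst ` (A \<inter> U)) \<and> openin Y (snd ` (A \<inter> U)))"

text \<open>The map need only be specified on \<open>F\<close>; its values elsewhere are irrelevant, and openness is
  relative to the subspace topology of \<open>G\<close>.\<close>

definition continuous_open_surjection ::
    "'a topology \<Rightarrow> 'a set \<Rightarrow> 'b topology \<Rightarrow> 'b set \<Rightarrow> ('a \<Rightarrow> 'b) \<Rightarrow> bool" where
  "continuous_open_surjection X F Y G f \<longleftrightarrow>
     continuous_map (subtopology X F) (subtopology Y G) f \<and>
     open_map (subtopology X F) (subtopology Y G) f \<and>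
     f ` F = G"

end

theory Submission
  imports Defs
begin

text \<open>
  Call a pair of open sets \<open>(U, V)\<close> a box if \<open>A \<inter> U \<times> V\<close> projects onto both \<open>U\<close> and \<open>V\<close>; since \<open>A\<close>
  has locally open projections, every point of \<open>A\<close> lies in arbitrarily small boxes.  If every box of
  some class can be refined by small boxes of the class with pairwise disjoint first sides, such that
  the sides of the refining boxes are dense in the sides of the given box, then iterating the
  refinement defines a continuous function on a dense \<open>G\<^sub>\<delta>\<close> subset of the first side whose graph lies
  in \<open>A\<close>, and a Baire category argument makes it an open map onto a dense \<open>G\<^sub>\<delta>\<close> subset of the second
  side.

  A box \<open>(U, V)\<close> is tight if every nonempty open \<open>Q \<subseteq> V\<close> contains all points of \<open>V\<close> related to some
  nonempty open \<open>W \<subseteq> U\<close>.  If every box contains a tight one, then tight boxes can be refined by tight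
  boxes with disjoint first sides: a point whose partners all lie outside the second sides chosen so
  far cannot belong to the first sides chosen so far.  Otherwise some box has no tight subbox.  Then
  one can choose small boxes one after the other with disjoint second sides so that at no finite
  stage the closed union of these sides contains all partners of a nonempty open subset of \<open>U\<close>;
  hence the choice can go on until the first sides are dense in \<open>U\<close>, and the map goes from
  \<open>Y\<close> to \<open>X\<close>.
\<close>

subsection \<open>Topological preliminaries\<close>

lemma gdelta_in_continuous_map_preimage:
  assumes "continuous_map X Y f" "gdelta_in Y S"
  shows "gdelta_in X {x \<in> topspace X. f x \<in> S}"
proof -
  obtain C :: "nat \<Rightarrow> _" where C: "\<And>n. openin Y (C n)" "\<And>n. C (Suc n) \<subseteq> C n" "\<Inter>(range C) = S"
    using assms(2) unfolding gdelta_in_descending by blast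
  have "openin X {x \<in> topspace X. f x \<in> C n}" for n
    using assms(1) C(1) openin_continuous_map_preimage by blast
  moreover have "\<Inter>(range (\<lambda>n. {x \<in> topspace X. f x \<in> C n})) = {x \<in> topspace X. f x \<in> S}"
    using C(3) by auto
  ultimately show ?thesis
    unfolding gdelta_in_descending using C(2)
    by (intro exI [where x="\<lambda>n. {x \<in> topspace X. f x \<in> C n}"]) blast
qed

text \<open>The Baire category theorem with density phrased as meeting every nonempty open set. It
  is applied to open sets enlarged by the exterior of a box side, which are dense in the whole
  space, so that no open subspace has to be considered.\<close>

lemma Baire_meets_open:
  assumes "completely_metrizable_space X" "countable \<G>"
    and "\<And>T. T \<in> \<G> \<Longrightarrow> openin X T"
    and "\<And>T W. T \<in> \<G> \<Longrightarrow> openin X W \<Longrightarrow> W \<noteq> {} \<Longrightarrow> W \<inter> T \<noteq> {}"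
    and "openin X W" "W \<noteq> {}"
  shows "\<exists>x\<in>W. \<forall>T\<in>\<G>. x \<in> T"
proof -
  have "X closure_of \<Inter>\<G> = topspace X"
  proof (rule Baire_category)
    fix T assume "T \<in> \<G>"
    then show "openin X T \<and> X closure_of T = topspace X"
      using assms(3,4) by (metis dense_intersects_open inf_commute)
  qed (use assms in auto)
  then have "\<Inter>\<G> \<inter> W \<noteq> {}"
    using assms(5,6) dense_intersects_open by blast
  then show ?thesis by blast
qed

text \<open>Points of a countable dense set picked from disjoint members are distinct. The indexing
  by \<open>U\<close> allows boxes to be counted by their first sides.\<close>

lemma countable_disjoint_open_family:
  assumes "separable_space X"
    and "\<And>c. c \<in> C \<Longrightarrow> openin X (U c) \<and> U c \<noteq> {}"
    and "\<And>c c' x. c \<in> C \<Longrightarrow> c' \<in> C \<Longrightarrow> x \<in> U c \<Longrightarrow> x \<in> U c' \<Longrightarrow> c = c'"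
  shows "countable C"
proof -
  obtain D where D: "countable D" "D \<subseteq> topspace X" "X closure_of D = topspace X"
    using assms(1) unfolding separable_space_def by blast
  have "\<exists>x. x \<in> D \<and> x \<in> U c" if "c \<in> C" for c
    using that assms(2) D(3) dense_intersects_open by blast
  then obtain p where p: "\<And>c. c \<in> C \<Longrightarrow> p c \<in> D \<and> p c \<in> U c"
    by metis
  have "inj_on p C"
    using p assms(3) by (metis inj_onI)
  moreover have "countable (p ` C)"
    using p D(1) by (meson countable_subset image_subsetI)
  ultimately show ?thesis
    using countable_image_inj_on by blast
qed

text \<open>Zorn's lemma: unions of chains of pairwise related sets are pairwise related. The last
  conclusion is maximality in usable form, since an element related to all of \<open>C\<close> could
  be inserted.\<close>

lemma maximal_pairwise_extension:
  assumes "C0 \<subseteq> S" "pairwise R C0"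
    and sym: "\<And>a b. R a b \<Longrightarrow> R b a"
  obtains C where "C0 \<subseteq> C" "C \<subseteq> S" "pairwise R C"
    "\<And>b. b \<in> S \<Longrightarrow> (\<And>c. c \<in> C \<Longrightarrow> R b c) \<Longrightarrow> b \<in> C"
proof -
  let ?F = "{C. C0 \<subseteq> C \<and> C \<subseteq> S \<and> pairwise R C}"
  have "\<exists>M\<in>?F. \<forall>X\<in>?F. M \<subseteq> X \<longrightarrow> X = M"
  proof (rule subset_Zorn_nonempty)
    show "?F \<noteq> {}" using assms by blast
    fix \<C> assume ne: "\<C> \<noteq> {}" and ch: "subset.chain ?F \<C>"
    have "pairwise R (\<Union>\<C>)"
    proof (rule pairwise_chain_Union)
      show "chain\<^sub>\<subseteq> \<C>" using ch unfolding subset_chain_def chain_subset_def by blast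
      show "pairwise R S'" if "S' \<in> \<C>" for S' using that ch unfolding subset_chain_def by blast
    qed
    then show "\<Union>\<C> \<in> ?F"
      using ne ch unfolding subset_chain_def by blast
  qed
  then obtain C where CF: "C \<in> ?F" and max: "\<forall>C'\<in>?F. C \<subseteq> C' \<longrightarrow> C' = C" ..
  then have C: "C0 \<subseteq> C" "C \<subseteq> S" "pairwise R C" by simp_all
  have "b \<in> C" if "b \<in> S" "\<And>c. c \<in> C \<Longrightarrow> R b c" for b
  proof -
    have "insert b C \<in> ?F"
      using C that sym by (auto simp: pairwise_insert)
    with max have "insert b C = C" by blast
    then show ?thesis by blast
  qed
  with C show thesis by (rule that)
qed

section \<open>Nested, shrinking and small open sets in metric spaces\<close>

context Metric_space
begin

text \<open>Cantor's intersection theorem for the closures of \<open>S (Suc n)\<close>. The common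
  point lies in the sets themselves because each closure is contained in the preceding set. The
  diameter bound starts at index 1, so \<open>S 0\<close> may be arbitrarily large.\<close>

lemma nested_open_sets_point:
  assumes "mcomplete" and "\<And>n. S n \<noteq> {}" "\<And>n. S n \<subseteq> M"
    and "\<And>n. mtopology closure_of (S (Suc n)) \<subseteq> S n"
    and "\<And>n x y. x \<in> S (Suc n) \<Longrightarrow> y \<in> S (Suc n) \<Longrightarrow> d x y \<le> 1 / Suc n"
  shows "\<exists>l. \<forall>n. l \<in> S n"
proof -
  define C where "C n = mtopology closure_of (S (Suc n))" for n
  have sub: "S n \<subseteq> mtopology closure_of (S n)" for n
    using assms(3) by (simp add: closure_of_subset)
  have "\<Inter>(range C) \<noteq> {}"
  proof (rule mcomplete_nest [THEN iffD1, rule_format, OF assms(1)], intro conjI allI impI)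
    show "closedin mtopology (C n)" for n by (simp add: C_def)
    show "C n \<noteq> {}" for n unfolding C_def using sub assms(2) by (metis subset_empty)
    show "decseq C"
      unfolding C_def by (rule decseq_SucI) (meson assms(4) sub subset_trans)
    fix e :: real assume "e > 0"
    then obtain n where n: "1 / Suc n < e" using nat_approx_posE by blast
    obtain a where a: "a \<in> S (Suc n)" using assms(2) by blast
    have "S (Suc n) \<subseteq> mcball a e"
      using a assms(3) assms(5)[OF a] n by (force simp: subset_iff)
    then have "C n \<subseteq> mcball a e"
      unfolding C_def by (simp add: closure_of_minimal)
    then show "\<exists>n a. C n \<subseteq> mcball a e" by blast
  qed
  then obtain l where "\<And>n. l \<in> C n" by blast
  then show ?thesis unfolding C_def using assms(4) by blast
qed

lemma shrinking_sets_in_neighbourhood: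
  assumes "\<And>n. S n \<subseteq> M" "\<And>n. l \<in> S n"
    and "\<And>n x y. x \<in> S (Suc n) \<Longrightarrow> y \<in> S (Suc n) \<Longrightarrow> d x y \<le> 1 / Suc n"
    and "openin mtopology W" "l \<in> W"
  shows "\<exists>n. S n \<subseteq> W"
proof -
  obtain e where e: "e > 0" "mball l e \<subseteq> W"
    using assms(4,5) openin_mtopology by blast
  then obtain n where n: "1 / Suc n < e" using nat_approx_posE by blast
  have "S (Suc n) \<subseteq> mball l e"
    using assms(1,2) assms(3)[OF assms(2)] n by (force simp: subset_iff)
  then show ?thesis using e by blast
qed

lemma shrinking_sets_unique:
  assumes "\<And>n. S n \<subseteq> M" "\<And>n. l \<in> S n" "\<And>n. l' \<in> S n"
    and "\<And>n x y. x \<in> S (Suc n) \<Longrightarrow> y \<in> S (Suc n) \<Longrightarrow> d x y \<le> 1 / Suc n"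
  shows "l = l'"
proof (rule ccontr)
  assume "l \<noteq> l'"
  then have "d l l' > 0" using assms(1,2,3) by (metis mdist_pos_eq subsetD)
  then obtain n where "1 / Suc n < d l l'" using nat_approx_posE by blast
  then show False using assms(2,3,4) by (metis not_le)
qed

text \<open>Balls of radius \<open>1 / Suc n\<close> about the points of a countable dense set. Such
  a list of open targets suffices to make a union of boxes dense: one second side is placed inside
  each target.\<close>

lemma countable_pi_base:
  assumes "separable_space mtopology"
  obtains \<P> where "countable \<P>" "\<And>P. P \<in> \<P> \<Longrightarrow> openin mtopology P \<and> P \<noteq> {}"
    "\<And>W. openin mtopology W \<Longrightarrow> W \<noteq> {} \<Longrightarrow> \<exists>P\<in>\<P>. P \<subseteq> W"
proof -
  obtain D where D: "countable D" "D \<subseteq> M" "mtopology closure_of D = M"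
    using assms unfolding separable_space_def by auto
  show thesis
  proof
    let ?P = "(\<lambda>(x, n::nat). mball x (1 / Suc n)) ` (D \<times> UNIV)"
    show "countable ?P" using D(1) by simp
    show "openin mtopology P \<and> P \<noteq> {}" if "P \<in> ?P" for P
      using that D(2) by (auto simp: mball_eq_empty)
    fix W assume W: "openin mtopology W" "W \<noteq> {}"
    then obtain x where x: "x \<in> D" "x \<in> W"
      using D(3) dense_intersects_open[of mtopology D] by auto
    then obtain e where e: "e > 0" "mball x e \<subseteq> W"
      using W(1) openin_mtopology by blast
    then obtain n where n: "1 / Suc n < e" using nat_approx_posE by blast
    have "mball x (1 / Suc n) \<subseteq> W"
      using n e(2) by (meson less_imp_le mball_subset_concentric subset_trans)
    then show "\<exists>P\<in>?P. P \<subseteq> W" using x(1) by auto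
  qed
qed

lemma small_open_neighbourhood:
  assumes "openin mtopology P" "x \<in> P" "e > 0"
  obtains U where "openin mtopology U" "x \<in> U" "mtopology closure_of U \<subseteq> P"
    "\<And>y z. y \<in> U \<Longrightarrow> z \<in> U \<Longrightarrow> d y z \<le> e"
proof -
  obtain r where r: "r > 0" "mball x r \<subseteq> P"
    using assms openin_mtopology by blast
  define s where "s = min (r / 2) (e / 2)"
  have s: "s > 0" "s < r" "2 * s \<le> e" using r assms(3) unfolding s_def by auto
  have x: "x \<in> M" using assms(1,2) openin_subset by fastforce
  show thesis
  proof
    show "openin mtopology (mball x s)" by simp
    show "x \<in> mball x s" using x s by simp
    have "mtopology closure_of mball x s \<subseteq> mcball x s"
      by (rule closure_of_minimal) auto
    also have "mcball x s \<subseteq> mball x r" using s by auto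
    finally show "mtopology closure_of mball x s \<subseteq> P" using r by blast
    fix y z assume "y \<in> mball x s" "z \<in> mball x s"
    then have "y \<in> M" "z \<in> M" "d x y < s" "d x z < s" by auto
    moreover have "d y z \<le> d x y + d x z"
      using triangle[of y x z] x \<open>y \<in> M\<close> \<open>z \<in> M\<close> by (simp add: commute)
    ultimately show "d y z \<le> e" using s(3) by linarith
  qed
qed

end


subsection \<open>Open surjections from refining families of boxes\<close>

definition box :: "'a topology \<Rightarrow> 'b topology \<Rightarrow> ('a \<times> 'b) set \<Rightarrow> 'a set \<times> 'b set \<Rightarrow> bool" where
  "box X Y A b \<longleftrightarrow> openin X (fst b) \<and> openin Y (snd b) \<and> fst b \<noteq> {} \<and> snd b \<noteq> {} \<and>
     (\<forall>x\<in>fst b. \<exists>y\<in>snd b. (x, y) \<in> A) \<and> (\<forall>y\<in>snd b. \<exists>x\<in>fst b. (x, y) \<in> A)"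

definition tight :: "'a topology \<Rightarrow> 'b topology \<Rightarrow> ('a \<times> 'b) set \<Rightarrow> 'a set \<times> 'b set \<Rightarrow> bool" where
  "tight X Y A b \<longleftrightarrow> (\<forall>Q. openin Y Q \<longrightarrow> Q \<noteq> {} \<longrightarrow> Q \<subseteq> snd b \<longrightarrow>
     (\<exists>W. openin X W \<and> W \<noteq> {} \<and> W \<subseteq> fst b \<and> (\<forall>x\<in>W. \<forall>y\<in>snd b. (x, y) \<in> A \<longrightarrow> y \<in> Q)))"

locale complete_separable_pair =
  MX: Metric_space MX dX + MY: Metric_space MY dY
  for MX :: "'a set" and dX and MY :: "'b set" and dY +
  assumes complete_X: "MX.mcomplete" and complete_Y: "MY.mcomplete"
    and separable_X: "separable_space MX.mtopology"
    and separable_Y: "separable_space MY.mtopology"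
begin

abbreviation "X \<equiv> MX.mtopology"
abbreviation "Y \<equiv> MY.mtopology"

text \<open>Closures make the limits of nested boxes stay inside every box, and the third conjunct
  puts the limit pair into \<open>D n\<close>. The last two make both sides shrink to
  points.\<close>

definition refines ::
  "(nat \<Rightarrow> ('a \<times> 'b) set) \<Rightarrow> nat \<Rightarrow> 'a set \<times> 'b set \<Rightarrow> 'a set \<times> 'b set \<Rightarrow> bool" where
  "refines D n b c \<longleftrightarrow>
     X closure_of fst c \<subseteq> fst b \<and> Y closure_of snd c \<subseteq> snd b \<and>
     (X closure_of fst c) \<times> (Y closure_of snd c) \<subseteq> D n \<and>
     (\<forall>x\<in>fst c. \<forall>x'\<in>fst c. dX x x' \<le> 1 / Suc n) \<and>
     (\<forall>y\<in>snd c. \<forall>y'\<in>snd c. dY y y' \<le> 1 / Suc n)"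

text \<open>Disjoint first sides make the box over a point unique, so that the limit is a function.
  Second sides may overlap, since the function may take a value at many points.\<close>

definition refining_family ::
  "(nat \<Rightarrow> ('a \<times> 'b) set) \<Rightarrow> nat \<Rightarrow> 'a set \<times> 'b set \<Rightarrow> ('a set \<times> 'b set) set \<Rightarrow> bool" where
  "refining_family D n b C \<longleftrightarrow>
     (\<forall>c\<in>C. refines D n b c) \<and> pairwise (\<lambda>c c'. disjnt (fst c) (fst c')) C \<and>
     (\<forall>W. openin X W \<longrightarrow> W \<inter> fst b \<noteq> {} \<longrightarrow> (\<exists>c\<in>C. W \<inter> fst c \<noteq> {})) \<and>
     (\<forall>W. openin Y W \<longrightarrow> W \<inter> snd b \<noteq> {} \<longrightarrow> (\<exists>c\<in>C. W \<inter> snd c \<noteq> {}))"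

text \<open>Iterated refinement gives a tree of boxes. A point lying in first sides at every level
  determines a branch, and its value is the common point of the second sides along that branch.
  Openness comes from the cells: after restriction to a suitable \<open>G\<close>, the part over a
  first side is mapped onto the whole part of \<open>G\<close> in the second side.\<close>

lemma open_surjection_from_refining_families:
  assumes "b0 \<in> \<B>"
    and nonempty_open: "\<And>b. b \<in> \<B> \<Longrightarrow> openin X (fst b) \<and> openin Y (snd b) \<and> fst b \<noteq> {} \<and> snd b \<noteq> {}"
    and refine: "\<And>b n. b \<in> \<B> \<Longrightarrow> \<exists>C\<subseteq>\<B>. refining_family D n b C"
  shows "\<exists>F G f. almost_open_in X F \<and> F \<noteq> {} \<and> almost_open_in Y G \<and> G \<noteq> {} \<and>
           continuous_open_surjection X F Y G f \<and> {(x, f x) |x. x \<in> F} \<subseteq> \<Inter>(range D)"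
proof -
  have cmX: "completely_metrizable_space X" and cmY: "completely_metrizable_space Y"
    using complete_X complete_Y MX.completely_metrizable_space_mtopology
      MY.completely_metrizable_space_mtopology by auto
  obtain K where K: "\<And>b n. b \<in> \<B> \<Longrightarrow> K b n \<subseteq> \<B>"
      and Kref: "\<And>b n. b \<in> \<B> \<Longrightarrow> refining_family D n b (K b n)"
    using refine by metis
  \<comment> \<open>\<open>L n\<close> is the n-th level of the tree rooted at \<open>b0\<close>; a
    box of level n is refined with precision index n, so diameters are bounded from level 1
    on.\<close>
  define L where "L = rec_nat {b0} (\<lambda>n S. \<Union>c\<in>S. K c n)"
  have L0: "L 0 = {b0}" and LSuc: "\<And>n. L (Suc n) = (\<Union>c\<in>L n. K c n)"
    by (simp_all add: L_def)
  have LB: "L n \<subseteq> \<B>" for n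
  proof (induction n)
    case (Suc n)
    then show ?case using K unfolding LSuc by blast
  qed (simp add: L0 assms(1))
  have Kr: "refines D n p c" if "p \<in> \<B>" "c \<in> K p n" for p c n
    using Kref[OF that(1), of n] that(2) unfolding refining_family_def by blast
  have Kfst: "\<exists>c\<in>K p n. W \<inter> fst c \<noteq> {}" if "p \<in> \<B>" "openin X W" "W \<inter> fst p \<noteq> {}" for p n W
    using Kref[OF that(1), of n] that(2,3) unfolding refining_family_def by (elim conjE) simp
  have Ksnd: "\<exists>c\<in>K p n. W \<inter> snd c \<noteq> {}" if "p \<in> \<B>" "openin Y W" "W \<inter> snd p \<noteq> {}" for p n W
    using Kref[OF that(1), of n] that(2,3) unfolding refining_family_def by (elim conjE) simp
  have sub: "fst c \<subseteq> MX" "snd c \<subseteq> MY" if "c \<in> \<B>" for c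
    using nonempty_open[OF that] openin_subset by fastforce+
  have Ksub: "fst c \<subseteq> fst p" "snd c \<subseteq> snd p" if "p \<in> \<B>" "c \<in> K p n" for p c n
  proof -
    have "c \<in> \<B>" using that K by blast
    then have "fst c \<subseteq> X closure_of fst c" "snd c \<subseteq> Y closure_of snd c"
      using sub by (simp_all add: closure_of_subset)
    then show "fst c \<subseteq> fst p" "snd c \<subseteq> snd p"
      using Kr[OF that] unfolding refines_def by auto
  qed
  \<comment> \<open>If two boxes of one level share a point of their first sides, so do their
    parents, which coincide by induction; siblings are disjoint by construction.\<close>
  have Ldisj: "c = c'" if "c \<in> L n" "c' \<in> L n" "x \<in> fst c" "x \<in> fst c'" for c c' x n
    using that
  proof (induction n arbitrary: c c')
    case 0
    then show ?case by (simp add: L0)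
  next
    case (Suc n)
    obtain p p' where p: "p \<in> L n" "c \<in> K p n" and p': "p' \<in> L n" "c' \<in> K p' n"
      using Suc.prems by (auto simp: LSuc)
    have pB: "p \<in> \<B>" "p' \<in> \<B>" using p p' LB by auto
    then have "x \<in> fst p" "x \<in> fst p'" using Ksub p p' Suc.prems(3,4) by blast+
    then have "p = p'" using Suc.IH p p' by blast
    moreover have "pairwise (\<lambda>c c'. disjnt (fst c) (fst c')) (K p n)"
      using Kref[OF pB(1), of n] unfolding refining_family_def by blast
    ultimately show ?case
      using p p' Suc.prems(3,4) unfolding pairwise_def disjnt_iff by blast
  qed
  define E where "E n = \<Union>(fst ` L n)" for n
  have Eopen: "openin X (E n)" for n
    unfolding E_def using LB nonempty_open by blast
  have Edec: "E (Suc n) \<subseteq> E n" for n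
  proof
    fix x assume "x \<in> E (Suc n)"
    then obtain p c where "p \<in> L n" "c \<in> K p n" "x \<in> fst c"
      unfolding E_def LSuc by blast
    then have "x \<in> fst p" using Ksub(1)[of p c n] LB[of n] by blast
    then show "x \<in> E n" using \<open>p \<in> L n\<close> unfolding E_def by blast
  qed
  have E0: "E 0 = fst b0" by (simp add: E_def L0)
  have Esub: "E n \<subseteq> E m" if "m \<le> n" for m n
    using that Edec by (metis decseqD decseq_SucI)
  have Lsnd: "snd c \<subseteq> snd b0" if "c \<in> L n" for c n
    using that
  proof (induction n arbitrary: c)
    case (Suc n)
    then obtain p where "p \<in> L n" "c \<in> K p n" by (auto simp: LSuc)
    then show ?case using Suc.IH[of p] Ksub(2)[of p c n] LB[of n] by blast
  qed (simp add: L0)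
  have Edense: "W \<inter> E n \<noteq> {}" if W: "openin X W" "W \<inter> fst b0 \<noteq> {}" for W n
  proof (induction n)
    case 0
    show ?case using W by (simp add: E0)
  next
    case (Suc n)
    then obtain p where p: "p \<in> L n" "W \<inter> fst p \<noteq> {}" unfolding E_def by blast
    then have "p \<in> \<B>" using LB by blast
    then obtain c where "c \<in> K p n" "W \<inter> fst c \<noteq> {}"
      using Kfst[of p W n] W(1) p(2) by blast
    then show ?case using p(1) unfolding E_def LSuc by blast
  qed
  \<comment> \<open>The points through which a branch runs at every level: the first approximation
    to the domain, on which \<open>f\<close> is continuous but perhaps not yet open.\<close>
  define F0 where "F0 = \<Inter>(range E)"
  have F0_gdelta: "gdelta_in X F0"
    unfolding F0_def gdelta_in_descending using Eopen Edec by blast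
  have F0_sub: "F0 \<subseteq> fst b0" using E0 unfolding F0_def by blast
  have "\<exists>c. c \<in> L n \<and> x \<in> fst c" if "x \<in> F0" for x n
    using that unfolding F0_def E_def by blast
  then obtain cell where cell: "\<And>x n. x \<in> F0 \<Longrightarrow> cell x n \<in> L n \<and> x \<in> fst (cell x n)"
    by metis
  have cell_eq: "cell x n = c" if "x \<in> F0" "c \<in> L n" "x \<in> fst c" for x n c
    using Ldisj cell that by blast
  have cellB: "cell x n \<in> \<B>" if "x \<in> F0" for x n
    using cell LB that by blast
  have cellK: "cell x (Suc n) \<in> K (cell x n) n" if x: "x \<in> F0" for x n
  proof -
    obtain p where p: "p \<in> L n" "cell x (Suc n) \<in> K p n"
      using cell[OF x, of "Suc n"] by (auto simp: LSuc)
    then have "x \<in> fst p" using Ksub(1)[OF _ p(2)] LB[of n] cell[OF x, of "Suc n"] by blast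
    then show ?thesis using p cell_eq[OF x p(1)] by simp
  qed
  have Kdiam: "X closure_of fst c \<subseteq> fst p" "Y closure_of snd c \<subseteq> snd p"
      "(X closure_of fst c) \<times> (Y closure_of snd c) \<subseteq> D n"
      "\<And>x y. x \<in> fst c \<Longrightarrow> y \<in> fst c \<Longrightarrow> dX x y \<le> 1 / Suc n"
      "\<And>x y. x \<in> snd c \<Longrightarrow> y \<in> snd c \<Longrightarrow> dY x y \<le> 1 / Suc n"
    if "p \<in> \<B>" "c \<in> K p n" for p c n
    using Kr[OF that] unfolding refines_def by blast+
  \<comment> \<open>Completeness of \<open>Y\<close> provides the value at \<open>x\<close> as the
    point common to all second sides along the branch of \<open>x\<close>.\<close>
  have "\<exists>y. \<forall>n. y \<in> snd (cell x n)" if x: "x \<in> F0" for x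
  proof (rule MY.nested_open_sets_point[OF complete_Y])
    show "snd (cell x n) \<noteq> {}" for n using nonempty_open cellB[OF x] by blast
    show "snd (cell x n) \<subseteq> MY" for n using sub cellB[OF x] by blast
    show "Y closure_of snd (cell x (Suc n)) \<subseteq> snd (cell x n)" for n
      using Kdiam(2) cellB[OF x] cellK[OF x] by blast
    show "dY y y' \<le> 1 / Suc n" if "y \<in> snd (cell x (Suc n))" "y' \<in> snd (cell x (Suc n))" for n y y'
      using Kdiam(5)[OF cellB[OF x] cellK[OF x]] that by blast
  qed
  then obtain f where f: "\<And>x n. x \<in> F0 \<Longrightarrow> f x \<in> snd (cell x n)" by metis
  have f_mem: "f x \<in> snd c" if "x \<in> F0" "c \<in> L n" "x \<in> fst c" for x c n
    using f[OF that(1), of n] cell_eq[OF that] by simp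
  have f_graph: "(x, f x) \<in> D n" if x: "x \<in> F0" for x n
  proof -
    have "x \<in> X closure_of fst (cell x (Suc n))" "f x \<in> Y closure_of snd (cell x (Suc n))"
      using cell[OF x, of "Suc n"] f[OF x, of "Suc n"] sub[OF cellB[OF x, of "Suc n"]]
      by (simp_all add: closure_of_subset [THEN subsetD])
    then show ?thesis using Kdiam(3)[OF cellB[OF x] cellK[OF x]] by blast
  qed
  have small_snd: "\<exists>n. snd (cell x n) \<subseteq> W" if x: "x \<in> F0" and W: "openin Y W" "f x \<in> W" for x W
  proof (rule MY.shrinking_sets_in_neighbourhood[OF _ f[OF x] _ W])
    show "snd (cell x n) \<subseteq> MY" for n using sub cellB[OF x] by blast
    show "dY y y' \<le> 1 / Suc n" if "y \<in> snd (cell x (Suc n))" "y' \<in> snd (cell x (Suc n))" for n y y'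
      using Kdiam(5)[OF cellB[OF x] cellK[OF x]] that by blast
  qed
  have small_fst: "\<exists>n. fst (cell x n) \<subseteq> W" if x: "x \<in> F0" and W: "openin X W" "x \<in> W" for x W
  proof (rule MX.shrinking_sets_in_neighbourhood[OF _ _ _ W])
    show "fst (cell x n) \<subseteq> MX" for n using sub cellB[OF x] by blast
    show "x \<in> fst (cell x n)" for n using cell[OF x] by blast
    show "dX y y' \<le> 1 / Suc n" if "y \<in> fst (cell x (Suc n))" "y' \<in> fst (cell x (Suc n))" for n y y'
      using Kdiam(4)[OF cellB[OF x] cellK[OF x]] that by blast
  qed
  have F0_top: "F0 \<subseteq> topspace X" using F0_gdelta gdelta_in_subset by blast
  have f_cont: "continuous_map (subtopology X F0) Y f"
    unfolding continuous_map_def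
  proof (intro conjI allI impI)
    have "f x \<in> MY" if "x \<in> F0" for x
      using f[OF that, of 0] sub(2)[OF cellB[OF that, of 0]] by blast
    then show "f \<in> topspace (subtopology X F0) \<rightarrow> topspace Y" by auto
    fix W assume W: "openin Y W"
    show "openin (subtopology X F0) {x \<in> topspace (subtopology X F0). f x \<in> W}"
    proof (subst openin_subopen, intro ballI)
      fix x assume "x \<in> {x \<in> topspace (subtopology X F0). f x \<in> W}"
      then have x: "x \<in> F0" "f x \<in> W" by auto
      obtain n where n: "snd (cell x n) \<subseteq> W" using small_snd[OF x(1) W x(2)] by blast
      have "openin (subtopology X F0) (fst (cell x n) \<inter> F0)"
        using nonempty_open[OF cellB[OF x(1)]] by (simp add: openin_subtopology_Int)
      moreover have "fst (cell x n) \<inter> F0 \<subseteq> {x \<in> topspace (subtopology X F0). f x \<in> W}"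
        using f_mem[of _ "cell x n" n] cell[OF x(1), of n] n F0_top by auto
      ultimately show "\<exists>T. openin (subtopology X F0) T \<and> x \<in> T \<and>
          T \<subseteq> {x \<in> topspace (subtopology X F0). f x \<in> W}"
        using x(1) cell by blast
    qed
  qed

  define I where "I = (SIGMA n:UNIV. L n)"
  have "countable (L n)" for n
    by (rule countable_disjoint_open_family[OF separable_X, where U=fst])
      (use LB nonempty_open Ldisj in blast)+
  then have I_count: "countable I" unfolding I_def by simp
  \<comment> \<open>A point of \<open>N (n, c)\<close> that lies in \<open>snd c\<close> also lies
    in the second side of a child of \<open>c\<close>. Hence for a point of \<open>G\<close> every
    finite branch over it can be prolonged. Each \<open>N (n, c)\<close> is a union of a closed and
    an open set, thus a G-delta set in a metrizable space.\<close>
  define N where "N = (\<lambda>(n, c). (topspace Y - snd c) \<union> \<Union>(snd ` K c n))"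
  define G where "G = \<Inter>(insert (snd b0) (N ` I))"
  have KV: "openin Y (\<Union>(snd ` K c n))" if "c \<in> L n" for c n
    using that LB K nonempty_open by blast
  have G_gdelta: "gdelta_in Y G"
    unfolding G_def
  proof (rule gdelta_in_Inter)
    fix T assume "T \<in> insert (snd b0) (N ` I)"
    then consider "T = snd b0" | n c where "c \<in> L n" "T = (topspace Y - snd c) \<union> \<Union>(snd ` K c n)"
      unfolding N_def I_def by auto
    then show "gdelta_in Y T"
    proof cases
      case 1
      then show ?thesis using nonempty_open assms(1) open_imp_gdelta_in by blast
    next
      case 2
      have "gdelta_in Y (topspace Y - snd c)"
        using nonempty_open[of c] 2(1) LB[of n]
        by (intro closed_imp_gdelta_in MY.metrizable_space_mtopology closedin_diff) blast+
      then show ?thesis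
        unfolding 2(2) using open_imp_gdelta_in[OF KV[OF 2(1)]] by (rule gdelta_in_Un)
    qed
  qed (use I_count in auto)
  have G_dense: "W \<inter> G \<noteq> {}" if W: "openin Y W" "W \<inter> snd b0 \<noteq> {}" for W
  proof -
    \<comment> \<open>\<open>N\<close> need not be open, so Baire is applied to these smaller open
      sets: the complement of \<open>snd c\<close> is replaced by that of its closure. They are
      dense because the second sides of the children are dense in \<open>snd c\<close>.\<close>
    define T where "T = (\<lambda>(n, c). (topspace Y - Y closure_of snd c) \<union> \<Union>(snd ` K c n))"
    have "\<exists>y\<in>W \<inter> snd b0. \<forall>S\<in>T ` I. y \<in> S"
    proof (rule Baire_meets_open[OF cmY])
      show "countable (T ` I)" using I_count by simp
      show "openin Y S" if "S \<in> T ` I" for S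
        using that KV unfolding T_def I_def by (auto intro!: openin_Un openin_diff)
      show "V \<inter> S \<noteq> {}" if S: "S \<in> T ` I" and V: "openin Y V" "V \<noteq> {}" for S V
      proof -
        obtain n c where c: "c \<in> L n" "S = (topspace Y - Y closure_of snd c) \<union> \<Union>(snd ` K c n)"
          using S unfolding T_def I_def by auto
        have VY: "V \<subseteq> topspace Y" using V openin_subset by blast
        show ?thesis
        proof (cases "V \<inter> snd c = {}")
          case True
          then have "V \<inter> Y closure_of snd c = {}"
            using V(1) openin_Int_closure_of_eq_empty by blast
          then show ?thesis using V VY c(2) by blast
        next
          case False
          then obtain c' where "c' \<in> K c n" "V \<inter> snd c' \<noteq> {}"
            using Ksnd[of c V n] V(1) c(1) LB[of n] by blast
          then show ?thesis using c(2) by blast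
        qed
      qed
      show "openin Y (W \<inter> snd b0)" using W nonempty_open assms(1) by blast
    qed (use W in auto)
    then obtain y where y: "y \<in> W" "y \<in> snd b0" "\<And>i. i \<in> I \<Longrightarrow> y \<in> T i" by blast
    have "y \<in> N i" if i: "i \<in> I" for i
    proof -
      obtain n c where c: "i = (n, c)" "c \<in> L n" using i unfolding I_def by auto
      have "snd c \<subseteq> Y closure_of snd c"
        using sub(2)[of c] c(2) LB[of n] by (intro closure_of_subset) auto
      then show ?thesis using y(3)[OF i] unfolding c N_def T_def by auto
    qed
    then show ?thesis using y(1,2) unfolding G_def by blast
  qed
  have G_sub: "G \<subseteq> snd b0" unfolding G_def by blast
  have step: "\<exists>c'\<in>K c n. y \<in> snd c'" if "y \<in> G" "c \<in> L n" "y \<in> snd c" for y c n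
  proof -
    have "(n, c) \<in> I" using that(2) by (simp add: I_def)
    then have "y \<in> N (n, c)" using that(1) unfolding G_def by blast
    then show ?thesis using that(3) unfolding N_def by auto
  qed

  \<comment> \<open>Restricting to the preimage of \<open>G\<close> keeps only points whose values
    can be reached from every cell containing the value.\<close>
  define F where "F = {x \<in> F0. f x \<in> G}"
  have F_gdelta: "gdelta_in X F"
  proof -
    have "gdelta_in (subtopology X F0) {x \<in> topspace (subtopology X F0). f x \<in> G}"
      by (rule gdelta_in_continuous_map_preimage[OF f_cont G_gdelta])
    moreover have "{x \<in> topspace (subtopology X F0). f x \<in> G} = F"
      using F0_top unfolding F_def by auto
    ultimately show ?thesis using F0_gdelta gdelta_in_gdelta_subtopology by metis
  qed
  \<comment> \<open>From \<open>c\<close> on, children are chosen whose second sides contain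
    \<open>y\<close>. Their first sides shrink to a point \<open>x\<close> by completeness of
    \<open>X\<close>, and both \<open>f x\<close> and \<open>y\<close> lie in all the second sides,
    so they agree.\<close>
  have onto: "\<exists>x\<in>F. x \<in> fst c \<and> f x = y" if y: "y \<in> G" and c: "c \<in> L m" "y \<in> snd c" for y c m
  proof -
    have "\<exists>s. \<forall>k. (s k \<in> L (m + k) \<and> y \<in> snd (s k) \<and> (k = 0 \<longrightarrow> s k = c)) \<and> s (Suc k) \<in> K (s k) (m + k)"
    proof (rule dependent_nat_choice)
      show "\<exists>p. p \<in> L (m + 0) \<and> y \<in> snd p \<and> (0 = (0::nat) \<longrightarrow> p = c)"
        using c by (intro exI[of _ c]) simp
      fix p k assume p: "p \<in> L (m + k) \<and> y \<in> snd p \<and> (k = 0 \<longrightarrow> p = c)"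
      then obtain q where "q \<in> K p (m + k)" "y \<in> snd q"
        using step[OF y, of p "m + k"] by blast
      then show "\<exists>q. (q \<in> L (m + Suc k) \<and> y \<in> snd q \<and> (Suc k = 0 \<longrightarrow> q = c)) \<and> q \<in> K p (m + k)"
        using p by (intro exI[of _ q]) (auto simp: LSuc)
    qed
    then obtain s where s: "\<And>k. s k \<in> L (m + k)" "\<And>k. y \<in> snd (s k)" "s 0 = c"
      and sK: "\<And>k. s (Suc k) \<in> K (s k) (m + k)" by blast
    have sB: "s k \<in> \<B>" for k using s(1) LB by blast
    \<comment> \<open>The branch starts at level m, so its diameter bounds have index
      \<open>m + k\<close>; they imply the bounds with index k that the metric lemmas
      expect.\<close>
    have le: "1 / Suc (m + k) \<le> 1 / Suc k" for k
      by (simp add: frac_le)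
    have "\<exists>x. \<forall>k. x \<in> fst (s k)"
    proof (rule MX.nested_open_sets_point[OF complete_X])
      show "fst (s k) \<noteq> {}" "fst (s k) \<subseteq> MX" for k using nonempty_open sub sB by blast+
      show "X closure_of fst (s (Suc k)) \<subseteq> fst (s k)" for k using Kdiam(1) sB sK by blast
      show "dX x x' \<le> 1 / Suc k" if "x \<in> fst (s (Suc k))" "x' \<in> fst (s (Suc k))" for k x x'
        using Kdiam(4)[OF sB sK that] le order_trans by blast
    qed
    then obtain x where x: "\<And>k. x \<in> fst (s k)" by blast
    have "x \<in> E n" for n
    proof -
      have "x \<in> E (m + n)" using x s(1) unfolding E_def by blast
      then show ?thesis using Esub[of n "m + n"] by auto
    qed
    then have x0: "x \<in> F0" unfolding F0_def by blast
    have "f x = y"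
    proof (rule MY.shrinking_sets_unique[where S="\<lambda>k. snd (s k)"])
      show "snd (s k) \<subseteq> MY" for k using sub sB by blast
      show "f x \<in> snd (s k)" for k using f_mem[OF x0 s(1) x] .
      show "dY z z' \<le> 1 / Suc k" if "z \<in> snd (s (Suc k))" "z' \<in> snd (s (Suc k))" for k z z'
        using Kdiam(5)[OF sB sK that] le order_trans by blast
    qed (rule s(2))
    then show ?thesis using x0 x[of 0] s(3) y unfolding F_def by blast
  qed
  \<comment> \<open>The central identity: it yields surjectivity, the density of \<open>F\<close>,
    and the openness of \<open>f\<close>, because cells are arbitrarily small
    neighbourhoods.\<close>
  have image_cell: "f ` (F \<inter> fst c) = G \<inter> snd c" if c: "c \<in> L n" for c n
  proof
    show "f ` (F \<inter> fst c) \<subseteq> G \<inter> snd c"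
      using f_mem[OF _ that] unfolding F_def by blast
    show "G \<inter> snd c \<subseteq> f ` (F \<inter> fst c)"
    proof
      fix y assume "y \<in> G \<inter> snd c"
      then obtain x where "x \<in> F" "x \<in> fst c" "f x = y" using onto[of y c n] c by blast
      then show "y \<in> f ` (F \<inter> fst c)" by blast
    qed
  qed
  have fF: "f ` F = G"
  proof -
    have "F \<inter> fst b0 = F" using F0_sub unfolding F_def by blast
    moreover have "G \<inter> snd b0 = G" using G_sub by blast
    ultimately show ?thesis using image_cell[of b0 0] L0 by simp
  qed
  have F_meets: "F \<inter> fst c \<noteq> {}" if "c \<in> L n" for c n
  proof -
    have "c \<in> \<B>" using that LB by blast
    moreover have "snd c \<inter> snd b0 \<noteq> {}" using nonempty_open[OF \<open>c \<in> \<B>\<close>] Lsnd[OF that] by blast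
    ultimately have "snd c \<inter> G \<noteq> {}" using G_dense nonempty_open by blast
    then show ?thesis using image_cell[OF that] by blast
  qed
  \<comment> \<open>Baire yields a point of \<open>F0\<close> in \<open>W\<close>; a cell around
    this point fits into \<open>W\<close>, and every cell contains a point of \<open>F\<close>.
    Adding the exterior of \<open>fst b0\<close> makes each \<open>E n\<close> dense in the whole
    space.\<close>
  have F_dense: "W \<inter> F \<noteq> {}" if W: "openin X W" "W \<inter> fst b0 \<noteq> {}" for W
  proof -
    have "\<exists>x\<in>W \<inter> fst b0. \<forall>T\<in>range (\<lambda>n. E n \<union> (topspace X - X closure_of fst b0)). x \<in> T"
    proof (rule Baire_meets_open[OF cmX])
      fix T assume T: "T \<in> range (\<lambda>n. E n \<union> (topspace X - X closure_of fst b0))"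
      then obtain n where n: "T = E n \<union> (topspace X - X closure_of fst b0)" by blast
      show "openin X T"
        unfolding n using Eopen by (intro openin_Un openin_diff) auto
      fix V assume V: "openin X V" "V \<noteq> {}"
      have VX: "V \<subseteq> topspace X" using V openin_subset by blast
      show "V \<inter> T \<noteq> {}"
      proof (cases "V \<inter> fst b0 = {}")
        case True
        then have "V \<inter> X closure_of fst b0 = {}"
          using V(1) openin_Int_closure_of_eq_empty by blast
        then show ?thesis using V VX n by blast
      next
        case False
        then show ?thesis using Edense[OF V(1), of n] n by blast
      qed
    next
      show "openin X (W \<inter> fst b0)" using W(1) nonempty_open[OF assms(1)] by blast
    qed (use W(2) in auto)
    then obtain x where "x \<in> W \<inter> fst b0"
      and xE: "\<forall>T\<in>range (\<lambda>n. E n \<union> (topspace X - X closure_of fst b0)). x \<in> T" ..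
    then have x: "x \<in> W" "x \<in> fst b0" by simp_all
    have "x \<in> X closure_of fst b0"
      using x(2) sub(1)[OF assms(1)] by (simp add: closure_of_subset [THEN subsetD])
    then have "x \<in> E n" for n using xE[THEN bspec, OF rangeI, of n] by simp
    then have x0: "x \<in> F0" unfolding F0_def by blast
    obtain n where n: "fst (cell x n) \<subseteq> W" using small_fst[OF x0 W(1) x(1)] by blast
    then show ?thesis using F_meets[of "cell x n" n] cell[OF x0] by blast
  qed
  have almost_open: "S \<subseteq> Z interior_of (Z closure_of S)"
    if "openin Z U" "S \<subseteq> U" "\<And>W. openin Z W \<Longrightarrow> W \<inter> U \<noteq> {} \<Longrightarrow> W \<inter> S \<noteq> {}"
    for Z :: "'c topology" and S U
  proof -
    have "U \<subseteq> Z closure_of S"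
      using that openin_subset[OF that(1)] unfolding closure_of_def by blast
    then show ?thesis using that(1,2) interior_of_maximal by (meson subset_trans)
  qed
  have "almost_open_in X F"
    unfolding almost_open_in_def
    using F_gdelta almost_open[of X "fst b0" F] nonempty_open[OF assms(1)] F_dense F0_sub F_def by blast
  moreover have "almost_open_in Y G"
    unfolding almost_open_in_def
    using G_gdelta almost_open[of Y "snd b0" G] nonempty_open[OF assms(1)] G_dense G_sub by blast
  moreover have "F \<noteq> {}" using F_meets[of b0 0] L0 by blast
  moreover have "{(x, f x) |x. x \<in> F} \<subseteq> \<Inter>(range D)"
    using f_graph unfolding F_def by blast
  moreover have "continuous_map (subtopology X F) (subtopology Y G) f"
  proof -
    have "continuous_map (subtopology (subtopology X F0) F) Y f"
      using f_cont continuous_map_from_subtopology by blast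
    moreover have "F0 \<inter> F = F" unfolding F_def by blast
    ultimately show ?thesis
      using fF by (auto simp: subtopology_subtopology continuous_map_in_subtopology)
  qed
  moreover have "open_map (subtopology X F) (subtopology Y G) f"
    unfolding open_map_def
  proof (intro allI impI)
    fix S assume "openin (subtopology X F) S"
    then obtain W where W: "openin X W" "S = W \<inter> F" unfolding openin_subtopology by blast
    show "openin (subtopology Y G) (f ` S)"
    proof (subst openin_subopen, intro ballI)
      fix y assume "y \<in> f ` S"
      then obtain x where x: "x \<in> W" "x \<in> F" "y = f x" using W by blast
      then have x0: "x \<in> F0" unfolding F_def by blast
      obtain n where n: "fst (cell x n) \<subseteq> W" using small_fst[OF x0 W(1) x(1)] by blast
      have cl: "cell x n \<in> L n" "x \<in> fst (cell x n)" using cell[OF x0] by auto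
      have "openin (subtopology Y G) (snd (cell x n) \<inter> G)"
        using nonempty_open[OF cellB[OF x0]] by (simp add: openin_subtopology_Int)
      moreover have "y \<in> snd (cell x n) \<inter> G" using x f[OF x0] unfolding F_def by blast
      moreover have "snd (cell x n) \<inter> G \<subseteq> f ` S"
        using image_cell[OF cl(1)] n W(2) by blast
      ultimately show "\<exists>T. openin (subtopology Y G) T \<and> y \<in> T \<and> T \<subseteq> f ` S" by blast
    qed
  qed
  ultimately show ?thesis
    using fF unfolding continuous_open_surjection_def by blast
qed


section \<open>Small boxes inside a given open rectangle\<close>

lemma refines_mono:
  assumes "refines D n b c" "fst b \<subseteq> fst b'" "snd b \<subseteq> snd b'" "fst c' \<subseteq> fst c" "snd c' \<subseteq> snd c"
  shows "refines D n b' c'"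
proof -
  have "X closure_of fst c' \<subseteq> X closure_of fst c" "Y closure_of snd c' \<subseteq> Y closure_of snd c"
    using assms(4,5) by (simp_all add: closure_of_mono)
  then show ?thesis
    using assms unfolding refines_def
    by (elim conjE, intro conjI) (blast intro: subset_trans Sigma_mono)+
qed

text \<open>The open rectangle is first shrunk metrically around the point; the two projections of
  the part of \<open>A\<close> inside it are then open, and by their very definition form a
  box.\<close>

lemma small_box_at_point:
  assumes lop: "locally_open_projections X Y A"
    and "openin (prod_topology X Y) (D n)" "A \<subseteq> D n"
    and "openin X P" "openin Y Q" "x \<in> P" "y \<in> Q" "(x, y) \<in> A"
  obtains c where "box X Y A c" "refines D n (P, Q) c" "x \<in> fst c" "y \<in> snd c"
proof -
  have "(x, y) \<in> D n \<inter> P \<times> Q" "openin (prod_topology X Y) (D n \<inter> P \<times> Q)"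
    using assms by (auto simp: openin_prod_Times_iff)
  then obtain P1 Q1 where 1: "openin X P1" "openin Y Q1" "x \<in> P1" "y \<in> Q1"
      "P1 \<times> Q1 \<subseteq> D n \<inter> P \<times> Q"
    unfolding openin_prod_topology_alt by meson
  have pos: "1 / real (Suc n) > 0" by simp
  obtain P2 where P2: "openin X P2" "x \<in> P2" "X closure_of P2 \<subseteq> P1"
      "\<And>y z. y \<in> P2 \<Longrightarrow> z \<in> P2 \<Longrightarrow> dX y z \<le> 1 / Suc n"
    using MX.small_open_neighbourhood[OF 1(1,3) pos] by metis
  obtain Q2 where Q2: "openin Y Q2" "y \<in> Q2" "Y closure_of Q2 \<subseteq> Q1"
      "\<And>y z. y \<in> Q2 \<Longrightarrow> z \<in> Q2 \<Longrightarrow> dY y z \<le> 1 / Suc n"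
    using MY.small_open_neighbourhood[OF 1(2,4) pos] by metis
  define B where "B = A \<inter> P2 \<times> Q2"
  have "openin (prod_topology X Y) (P2 \<times> Q2)"
    using P2 Q2 by (simp add: openin_prod_Times_iff)
  then have op: "openin X (fst ` B)" "openin Y (snd ` B)"
    using lop unfolding locally_open_projections_def B_def by blast+
  have xy: "(x, y) \<in> B" using assms P2 Q2 unfolding B_def by blast
  have BA: "B \<subseteq> A" and B1: "fst ` B \<subseteq> P2" and B2: "snd ` B \<subseteq> Q2"
    unfolding B_def by auto
  show thesis
  proof
    show "box X Y A (fst ` B, snd ` B)"
      unfolding box_def using op xy BA by force
    have "refines D n (P, Q) (P2, Q2)"
      unfolding refines_def fst_conv snd_conv
    proof (intro conjI ballI)
      have "P1 \<subseteq> P" "Q1 \<subseteq> Q" using 1 by auto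
      then show "X closure_of P2 \<subseteq> P" "Y closure_of Q2 \<subseteq> Q" using P2(3) Q2(3) by auto
      show "(X closure_of P2) \<times> (Y closure_of Q2) \<subseteq> D n" using 1(5) P2(3) Q2(3) by blast
    qed (use P2(4) Q2(4) in auto)
    then show "refines D n (P, Q) (fst ` B, snd ` B)"
      by (rule refines_mono) (use B1 B2 in auto)
    show "x \<in> fst (fst ` B, snd ` B)" "y \<in> snd (fst ` B, snd ` B)"
      using xy by force+
  qed
qed

subsection \<open>Existence of refining families\<close>

text \<open>By maximality the first sides become dense: a small box over an open set that they all
  miss could be added. So it only remains to find a disjoint family whose second sides are
  dense.\<close>

lemma extend_to_refining_family:
  assumes "openin X (fst b)"
    and C0: "C0 \<subseteq> \<B>" "\<And>c. c \<in> C0 \<Longrightarrow> refines D n b c"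
      "pairwise (\<lambda>c c'. disjnt (fst c) (fst c')) C0"
    and dense_Y: "\<And>W. openin Y W \<Longrightarrow> W \<inter> snd b \<noteq> {} \<Longrightarrow> \<exists>c\<in>C0. W \<inter> snd c \<noteq> {}"
    and small: "\<And>W. openin X W \<Longrightarrow> W \<noteq> {} \<Longrightarrow> W \<subseteq> fst b \<Longrightarrow>
        \<exists>c\<in>\<B>. refines D n b c \<and> fst c \<noteq> {} \<and> fst c \<subseteq> W"
  shows "\<exists>C\<subseteq>\<B>. refining_family D n b C"
proof -
  have "C0 \<subseteq> {c \<in> \<B>. refines D n b c}" using C0 by blast
  from maximal_pairwise_extension[OF this C0(3)] obtain C where
    C: "C0 \<subseteq> C" "C \<subseteq> {c \<in> \<B>. refines D n b c}" "pairwise (\<lambda>c c'. disjnt (fst c) (fst c')) C"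
    and max: "\<And>c. c \<in> {c \<in> \<B>. refines D n b c} \<Longrightarrow>
        (\<And>c'. c' \<in> C \<Longrightarrow> disjnt (fst c) (fst c')) \<Longrightarrow> c \<in> C"
    by (metis (no_types, lifting) disjnt_sym)
  have dense_X: "\<exists>c\<in>C. W \<inter> fst c \<noteq> {}" if W: "openin X W" "W \<inter> fst b \<noteq> {}" for W
  proof (rule ccontr)
    assume none: "\<not> ?thesis"
    have "openin X (W \<inter> fst b)" using W assms(1) by blast
    then obtain c where c: "c \<in> \<B>" "refines D n b c" "fst c \<noteq> {}" "fst c \<subseteq> W \<inter> fst b"
      using small[of "W \<inter> fst b"] W(2) by blast
    have "disjnt (fst c) (fst c')" if "c' \<in> C" for c'
      using none that c(4) unfolding disjnt_def by blast
    then have "c \<in> C" using max c(1,2) by simp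
    then show False using none c(3,4) by blast
  qed
  have "refining_family D n b C"
    unfolding refining_family_def
  proof (intro conjI allI impI)
    show "\<forall>c\<in>C. refines D n b c" using C(2) by blast
    show "pairwise (\<lambda>c c'. disjnt (fst c) (fst c')) C" by (rule C(3))
    show "\<exists>c\<in>C. W \<inter> fst c \<noteq> {}" if "openin X W" "W \<inter> fst b \<noteq> {}" for W
      using dense_X that by blast
    show "\<exists>c\<in>C. W \<inter> snd c \<noteq> {}" if "openin Y W" "W \<inter> snd b \<noteq> {}" for W
      using dense_Y[OF that] C(1) by blast
  qed
  then show ?thesis using C(2) by blast
qed

context
  fixes A :: "('a \<times> 'b) set" and D :: "nat \<Rightarrow> ('a \<times> 'b) set"
  assumes lop: "locally_open_projections X Y A"
    and D_open: "\<And>n. openin (prod_topology X Y) (D n)" and A_sub: "\<And>n. A \<subseteq> D n"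
begin

lemma box_topspace:
  assumes "box X Y A c"
  shows "fst c \<subseteq> X closure_of fst c" "snd c \<subseteq> Y closure_of snd c"
  using assms unfolding box_def by (auto intro!: closure_of_subset openin_subset)

text \<open>A maximal disjoint family of small tight boxes has dense second sides. If an open
  \<open>T\<close> were missed, tightness of \<open>b\<close> would give an open set of points all
  of whose partners in \<open>snd b\<close> lie in \<open>T\<close>, and a small tight box over it
  could be added.\<close>

lemma tight_refining_family:
  assumes dense: "\<And>b. box X Y A b \<Longrightarrow>
      \<exists>c. box X Y A c \<and> tight X Y A c \<and> fst c \<subseteq> fst b \<and> snd c \<subseteq> snd b"
    and b: "box X Y A b" "tight X Y A b"
  shows "\<exists>C\<subseteq>{c. box X Y A c \<and> tight X Y A c}. refining_family D n b C"
proof -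
  let ?S = "{c. box X Y A c \<and> tight X Y A c \<and> refines D n b c}"
  have bo: "openin X (fst b)" "openin Y (snd b)" using b(1) unfolding box_def by auto
  have small: "\<exists>c\<in>?S. fst c \<subseteq> P \<and> snd c \<subseteq> Q"
    if PQ: "openin X P" "openin Y Q" "P \<subseteq> fst b" "Q \<subseteq> snd b" "x \<in> P" "y \<in> Q" "(x, y) \<in> A" for P Q x y
  proof -
    obtain c where c: "box X Y A c" "refines D n (P, Q) c"
      using small_box_at_point[of A D n P Q x y] lop D_open A_sub PQ(1,2,5,6,7) by metis
    obtain c' where c': "box X Y A c'" "tight X Y A c'" "fst c' \<subseteq> fst c" "snd c' \<subseteq> snd c"
      using dense[OF c(1)] by blast
    have "fst c \<subseteq> P" "snd c \<subseteq> Q"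
      using c(2) box_topspace[OF c(1)] unfolding refines_def by auto
    moreover have "refines D n b c'"
      using c(2) by (rule refines_mono) (use PQ(3,4) c' in auto)
    ultimately show ?thesis using c' by blast
  qed
  let ?R = "\<lambda>c c'. disjnt (fst c) (fst c') \<and> disjnt (snd c) (snd c')"
  obtain C0 where C0: "C0 \<subseteq> ?S" "pairwise ?R C0"
    and max: "\<And>c. c \<in> ?S \<Longrightarrow> (\<And>c'. c' \<in> C0 \<Longrightarrow> ?R c c') \<Longrightarrow> c \<in> C0"
    using maximal_pairwise_extension[of "{}" ?S ?R] disjnt_sym pairwise_empty empty_subsetI
    by (metis (no_types, lifting))
  have C0_sub: "snd c \<subseteq> snd b" if "c \<in> C0" for c
    using that C0(1) box_topspace(2)[of c] unfolding refines_def by blast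
  show ?thesis
  proof (rule extend_to_refining_family[OF bo(1)])
    show "C0 \<subseteq> {c. box X Y A c \<and> tight X Y A c}" using C0(1) by blast
    show "refines D n b c" if "c \<in> C0" for c using C0(1) that by blast
    show "pairwise (\<lambda>c c'. disjnt (fst c) (fst c')) C0"
      using C0(2) by (simp add: pairwise_def)
    show "\<exists>c\<in>C0. T \<inter> snd c \<noteq> {}" if T: "openin Y T" "T \<inter> snd b \<noteq> {}" for T
    proof (rule ccontr)
      assume none: "\<not> ?thesis"
      have Q: "openin Y (T \<inter> snd b)" using T bo(2) by blast
      then obtain W where W: "openin X W" "W \<noteq> {}" "W \<subseteq> fst b"
        and WQ: "\<And>x y. x \<in> W \<Longrightarrow> y \<in> snd b \<Longrightarrow> (x, y) \<in> A \<Longrightarrow> y \<in> T"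
        using b(2) T(2) unfolding tight_def by (metis IntE inf_le2)
      obtain x y where xy: "x \<in> W" "y \<in> snd b" "(x, y) \<in> A"
        using W b(1) unfolding box_def by blast
      then obtain c where c: "c \<in> ?S" "fst c \<subseteq> W" "snd c \<subseteq> T \<inter> snd b"
        using small[OF W(1) Q W(3) _ xy(1) _ xy(3)] WQ by blast
      have "?R c c'" if c': "c' \<in> C0" for c'
      proof
        show "disjnt (snd c) (snd c')" using none c(3) c' unfolding disjnt_def by blast
        \<comment> \<open>A common point would be related to a point of \<open>snd c'\<close>, which misses \<open>T\<close>.\<close>
        show "disjnt (fst c) (fst c')"
        proof (rule ccontr)
          assume "\<not> disjnt (fst c) (fst c')"
          then obtain z where z: "z \<in> fst c" "z \<in> fst c'" unfolding disjnt_iff by blast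
          moreover have "box X Y A c'" using c' C0(1) by blast
          ultimately obtain w where w: "w \<in> snd c'" "(z, w) \<in> A" unfolding box_def by blast
          then have "w \<in> T" using WQ[of z w] z(1) c(2) C0_sub[OF c'] by blast
          then show False using none c' w(1) by blast
        qed
      qed
      then have "c \<in> C0" using max c(1) by blast
      moreover have "snd c \<noteq> {}" using c(1) unfolding box_def by blast
      ultimately show False using none c(3) by blast
    qed
    show "\<exists>c\<in>{c. box X Y A c \<and> tight X Y A c}. refines D n b c \<and> fst c \<noteq> {} \<and> fst c \<subseteq> W"
      if W: "openin X W" "W \<noteq> {}" "W \<subseteq> fst b" for W
    proof -
      obtain x y where xy: "x \<in> W" "y \<in> snd b" "(x, y) \<in> A"
        using W b(1) unfolding box_def by blast
      then obtain c where "c \<in> ?S" "fst c \<subseteq> W"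
        using small[OF W(1) bo(2) W(3) subset_refl xy] by blast
      moreover have "fst c \<noteq> {}" using \<open>c \<in> ?S\<close> unfolding box_def by blast
      ultimately show ?thesis by blast
    qed
  qed
qed

text \<open>Here the roles of \<open>X\<close> and \<open>Y\<close> are interchanged: tightness is that of the swapped box for
  the converse relation, and the closed set \<open>Z \<subseteq> X\<close> collects the first sides chosen so far.\<close>

lemma nowhere_tight_step:
  assumes b: "box X Y A b"
    and no_tight: "\<And>c. box X Y A c \<Longrightarrow> fst c \<subseteq> fst b \<Longrightarrow> snd c \<subseteq> snd b \<Longrightarrow>
      \<not> tight Y X (A\<inverse>) (prod.swap c)"
    and Z: "closedin X Z"
    and NS: "\<And>W. openin Y W \<Longrightarrow> W \<noteq> {} \<Longrightarrow> W \<subseteq> snd b \<Longrightarrow> \<exists>y\<in>W. \<exists>x\<in>fst b - Z. (x, y) \<in> A"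
    and P: "openin Y P" "P \<noteq> {}" "P \<subseteq> snd b"
  shows "\<exists>c. box X Y A c \<and> refines D n b c \<and> snd c \<subseteq> P \<and> fst c \<inter> Z = {} \<and>
    (\<forall>W. openin Y W \<longrightarrow> W \<noteq> {} \<longrightarrow> W \<subseteq> snd b \<longrightarrow>
       (\<exists>y\<in>W. \<exists>x\<in>fst b - (Z \<union> X closure_of fst c). (x, y) \<in> A))"
proof -
  have bo: "openin X (fst b)" "openin Y (snd b)" using b unfolding box_def by auto
  \<comment> \<open>\<open>U\<close> consists of the still available points with a partner in
    \<open>P\<close>, and \<open>V\<close> of all their partners in \<open>snd b\<close>. By open
    projections \<open>(U, V)\<close> is a box inside \<open>b\<close>.\<close>
  define U where "U = fst ` (A \<inter> (fst b - Z) \<times> P)"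
  have "openin X (fst b - Z)" using bo Z by blast
  then have U: "openin X U"
    using lop P(1) unfolding U_def locally_open_projections_def
    by (metis openin_prod_Times_iff)
  define V where "V = snd ` (A \<inter> U \<times> snd b)"
  have V: "openin Y V"
    using lop U bo(2) unfolding V_def locally_open_projections_def
    by (metis openin_prod_Times_iff)
  have Ub: "U \<subseteq> fst b" "U \<inter> Z = {}" "V \<subseteq> snd b" unfolding U_def V_def by auto
  have UP: "\<exists>y\<in>P. (x, y) \<in> A" if "x \<in> U" for x using that unfolding U_def by auto
  have "U \<noteq> {}" using NS[OF P] unfolding U_def by force
  then obtain x0 where "x0 \<in> U" by blast
  have Vmem: "y \<in> V" if "x \<in> U" "y \<in> snd b" "(x, y) \<in> A" for x y
    using that unfolding V_def by force
  have "box X Y A (U, V)"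
    unfolding box_def fst_conv snd_conv
  proof (intro conjI ballI)
    show "\<exists>y\<in>V. (x, y) \<in> A" if "x \<in> U" for x
      using UP[OF that] Vmem[OF that] P(3) by blast
    then show "V \<noteq> {}" using \<open>x0 \<in> U\<close> by blast
    show "\<exists>x\<in>U. (x, y) \<in> A" if "y \<in> V" for y using that unfolding V_def by auto
  qed (use U V \<open>U \<noteq> {}\<close> in auto)
  \<comment> \<open>Failure of tightness yields an open \<open>Q \<subseteq> U\<close> such that
    every nonempty open part of \<open>V\<close> has a point with a partner in \<open>U - Q\<close>.
    A box with closed first side inside \<open>Q\<close> can therefore be removed safely.\<close>
  then have "\<not> tight Y X (A\<inverse>) (V, U)" using no_tight[of "(U, V)"] Ub by simp
  then obtain Q where Q: "openin X Q" "Q \<noteq> {}" "Q \<subseteq> U"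
    and Q_max: "\<not> (\<exists>W. openin Y W \<and> W \<noteq> {} \<and> W \<subseteq> V \<and>
      (\<forall>y\<in>W. \<forall>x\<in>U. (y, x) \<in> A\<inverse> \<longrightarrow> x \<in> Q))"
    unfolding tight_def not_all not_imp fst_conv snd_conv by (elim exE conjE) (rule that)
  have QW: "\<exists>y\<in>W. \<exists>x\<in>U. (x, y) \<in> A \<and> x \<notin> Q" if "openin Y W" "W \<noteq> {}" "W \<subseteq> V" for W
    using Q_max that unfolding converse_iff by blast
  obtain x where x: "x \<in> Q" using Q(2) by blast
  then obtain y where y: "y \<in> P" "(x, y) \<in> A" using UP Q(3) by blast
  obtain c where c: "box X Y A c" "refines D n (Q, P) c"
    using small_box_at_point[OF lop, of D n Q P x y] D_open A_sub Q(1) P(1) x y by metis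
  have cQ: "X closure_of fst c \<subseteq> Q" "fst c \<subseteq> Q" "snd c \<subseteq> P"
    using c(2) box_topspace[OF c(1)] unfolding refines_def by auto
  have "\<exists>y\<in>W. \<exists>x\<in>fst b - (Z \<union> X closure_of fst c). (x, y) \<in> A"
    if W: "openin Y W" "W \<noteq> {}" "W \<subseteq> snd b" for W
  proof -
    \<comment> \<open>An available partner outside \<open>Q\<close> survives. If it lies in
      \<open>Q\<close>, then \<open>W\<close> meets \<open>V\<close>, and the choice of
      \<open>Q\<close> supplies another point of \<open>W\<close> with a partner in
      \<open>U - Q\<close>.\<close>
    obtain y1 x1 where 1: "y1 \<in> W" "x1 \<in> fst b - Z" "(x1, y1) \<in> A" using NS[OF W] by blast
    show ?thesis
    proof (cases "x1 \<in> Q")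
      case False
      then show ?thesis using 1 cQ(1) by blast
    next
      case True
      then have "y1 \<in> W \<inter> V" using Vmem 1 Q(3) W(3) by blast
      then obtain y2 x2 where "y2 \<in> W" "x2 \<in> U" "(x2, y2) \<in> A" "x2 \<notin> Q"
        using QW[of "W \<inter> V"] W(1) V by blast
      then show ?thesis using Ub cQ(1) by blast
    qed
  qed
  moreover have "refines D n b c"
    using c(2) by (rule refines_mono) (use Q(3) Ub P(3) in auto)
  moreover have "fst c \<inter> Z = {}" using cQ Q(3) Ub by blast
  ultimately show ?thesis using c(1) cQ(3) by blast
qed

text \<open>One box is chosen for each member of a countable pi-base of \<open>snd b\<close>, with
  its second side inside that member; this makes the second sides dense. The first sides stay
  disjoint because each avoids the closures of the earlier ones.\<close>

lemma nowhere_tight_refining_family: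
  assumes b: "box X Y A b"
    and no_tight: "\<And>c. box X Y A c \<Longrightarrow> fst c \<subseteq> fst b \<Longrightarrow> snd c \<subseteq> snd b \<Longrightarrow>
      \<not> tight Y X (A\<inverse>) (prod.swap c)"
  shows "\<exists>C\<subseteq>{c. box X Y A c \<and> fst c \<subseteq> fst b \<and> snd c \<subseteq> snd b}. refining_family D n b C"
proof -
  let ?B = "{c. box X Y A c \<and> fst c \<subseteq> fst b \<and> snd c \<subseteq> snd b}"
  have bo: "openin X (fst b)" "openin Y (snd b)" "snd b \<noteq> {}" using b unfolding box_def by auto
  have in_B: "c \<in> ?B" if "box X Y A c" "refines D n b c" for c
    using that box_topspace[of c] unfolding refines_def by blast
  \<comment> \<open>The invariant that keeps the choice going: every nonempty open part of
    \<open>snd b\<close> has a point with a partner in \<open>fst b\<close> outside the closed set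
    \<open>Z\<close>. For empty \<open>Z\<close> it holds because \<open>b\<close> is a box.\<close>
  define NS where "NS Z \<longleftrightarrow> closedin X Z \<and> (\<forall>W. openin Y W \<longrightarrow> W \<noteq> {} \<longrightarrow> W \<subseteq> snd b \<longrightarrow>
      (\<exists>y\<in>W. \<exists>x\<in>fst b - Z. (x, y) \<in> A))" for Z
  have step: "\<exists>c. box X Y A c \<and> refines D n b c \<and> snd c \<subseteq> P \<and> fst c \<inter> Z = {} \<and>
      NS (Z \<union> X closure_of fst c)"
    if "NS Z" "openin Y P" "P \<noteq> {}" "P \<subseteq> snd b" for Z P
    using nowhere_tight_step[OF b no_tight, of Z P n] that unfolding NS_def
    by (simp add: closedin_Un)
  have NS0: "NS {}"
    using b unfolding NS_def box_def by (simp, blast)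
  obtain \<P> where \<P>: "countable \<P>" "\<And>P. P \<in> \<P> \<Longrightarrow> openin Y P \<and> P \<noteq> {}"
      "\<And>W. openin Y W \<Longrightarrow> W \<noteq> {} \<Longrightarrow> \<exists>P\<in>\<P>. P \<subseteq> W"
    using MY.countable_pi_base[OF separable_Y] by metis
  define \<P>' where "\<P>' = {P \<in> \<P>. P \<subseteq> snd b}"
  have "countable \<P>'" unfolding \<P>'_def using \<P>(1) by simp
  moreover have "\<P>' \<noteq> {}" unfolding \<P>'_def using \<P>(3)[OF bo(2,3)] by blast
  ultimately have P_range: "range (from_nat_into \<P>') = \<P>'" by (simp add: range_from_nat_into)
  \<comment> \<open>The enumeration may repeat members; each stage still chooses a box off the
    earlier ones.\<close>
  define P where "P = from_nat_into \<P>'"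
  have P: "openin Y (P k)" "P k \<noteq> {}" "P k \<subseteq> snd b" for k
  proof -
    have "P k \<in> \<P>'" using P_range unfolding P_def by blast
    then show "openin Y (P k)" "P k \<noteq> {}" "P k \<subseteq> snd b" using \<P>(2) unfolding \<P>'_def by auto
  qed
  \<comment> \<open>A state pairs the closed set \<open>Z\<close> used up so far with the box chosen
    at stage k; the last conjunct passes the invariant on to the next stage.\<close>
  define good where "good k s \<longleftrightarrow> NS (fst s) \<and> box X Y A (snd s) \<and> refines D n b (snd s) \<and>
      snd (snd s) \<subseteq> P k \<and> fst (snd s) \<inter> fst s = {} \<and> NS (fst s \<union> X closure_of fst (snd s))"
    for k and s :: "'a set \<times> 'a set \<times> 'b set"
  have ex_good: "\<exists>c. good k (Z, c)" if "NS Z" for Z k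
    using step[OF that P] that unfolding good_def by simp
  have "\<exists>s. \<forall>k. good k (s k) \<and> fst (s (Suc k)) = fst (s k) \<union> X closure_of fst (snd (s k))"
  proof (rule dependent_nat_choice)
    show "\<exists>s. good 0 s" using ex_good[OF NS0] by blast
    fix s k assume "good k s"
    then have "NS (fst s \<union> X closure_of fst (snd s))" unfolding good_def by blast
    then obtain c where "good (Suc k) (fst s \<union> X closure_of fst (snd s), c)"
      using ex_good by blast
    then show "\<exists>t. good (Suc k) t \<and> fst t = fst s \<union> X closure_of fst (snd s)"
      by (metis fst_conv)
  qed
  then obtain s where s: "\<And>k. good k (s k)"
    and sS: "\<And>k. fst (s (Suc k)) = fst (s k) \<union> X closure_of fst (snd (s k))" by blast
  define c where "c k = snd (s k)" for k
  have c: "box X Y A (c k)" "refines D n b (c k)" "snd (c k) \<subseteq> P k" "fst (c k) \<inter> fst (s k) = {}" for k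
    using s[of k] unfolding good_def c_def by auto
  have inc: "fst (s k) \<subseteq> fst (s m)" if "k \<le> m" for k m
    by (rule lift_Suc_mono_le[where f="\<lambda>k. fst (s k)", OF _ that]) (simp add: sS)
  have disj: "disjnt (fst (c k)) (fst (c m))" if "k < m" for k m
  proof -
    have "fst (c k) \<subseteq> fst (s (Suc k))" using sS box_topspace(1)[OF c(1)] unfolding c_def by blast
    also have "\<dots> \<subseteq> fst (s m)" using inc that by simp
    finally show ?thesis using c(4)[of m] unfolding disjnt_def by blast
  qed
  show ?thesis
  proof (rule extend_to_refining_family[OF bo(1), of "range c"])
    show "range c \<subseteq> ?B" using in_B c(1,2) by blast
    show "refines D n b d" if "d \<in> range c" for d using that c(2) by blast
    show "pairwise (\<lambda>c c'. disjnt (fst c) (fst c')) (range c)"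
      unfolding pairwise_def using disj disjnt_sym by (metis nat_neq_iff rangeE)
    show "\<exists>d\<in>range c. W \<inter> snd d \<noteq> {}" if W: "openin Y W" "W \<inter> snd b \<noteq> {}" for W
    proof -
      have "openin Y (W \<inter> snd b)" using W bo(2) by blast
      then obtain Q where "Q \<in> \<P>" "Q \<subseteq> W \<inter> snd b" using \<P>(3) W(2) by blast
      then have "Q \<in> range P" using P_range unfolding P_def \<P>'_def by blast
      then obtain k where k: "Q = P k" by blast
      have "snd (c k) \<noteq> {}" using c(1)[of k] unfolding box_def by blast
      then have "W \<inter> snd (c k) \<noteq> {}" using c(3)[of k] k \<open>Q \<subseteq> W \<inter> snd b\<close> by blast
      then show ?thesis by blast
    qed
    show "\<exists>c\<in>?B. refines D n b c \<and> fst c \<noteq> {} \<and> fst c \<subseteq> W"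
      if W: "openin X W" "W \<noteq> {}" "W \<subseteq> fst b" for W
    proof -
      obtain x y where xy: "x \<in> W" "y \<in> snd b" "(x, y) \<in> A"
        using W b unfolding box_def by blast
      obtain d where d: "box X Y A d" "refines D n (W, snd b) d"
        using small_box_at_point[OF lop, of D n W "snd b" x y] D_open A_sub W(1) bo(2) xy by metis
      have "refines D n b d" using d(2) by (rule refines_mono) (use W(3) in auto)
      moreover have "fst d \<subseteq> W" using d(2) box_topspace(1)[OF d(1)] unfolding refines_def by auto
      moreover have "fst d \<noteq> {}" using d(1) unfolding box_def by blast
      ultimately show ?thesis using in_B[OF d(1)] by blast
    qed
  qed
qed

end

end

section \<open>Exchange of the factors and the final case distinction\<close>

lemma openin_prod_converse:
  assumes "openin (prod_topology X Y) S"
  shows "openin (prod_topology Y X) (S\<inverse>)"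
  unfolding openin_prod_topology_alt
proof (intro allI impI)
  fix y x assume "(y, x) \<in> S\<inverse>"
  then obtain U V where "openin X U" "openin Y V" "x \<in> U" "y \<in> V" "U \<times> V \<subseteq> S"
    using assms unfolding openin_prod_topology_alt converse_iff by meson
  then show "\<exists>V U. openin Y V \<and> openin X U \<and> y \<in> V \<and> x \<in> U \<and> V \<times> U \<subseteq> S\<inverse>"
    by (intro exI[of _ V] exI[of _ U]) auto
qed

lemma locally_open_projections_converse:
  assumes "locally_open_projections X Y A"
  shows "locally_open_projections Y X (A\<inverse>)"
  unfolding locally_open_projections_def
proof (intro allI impI)
  fix U assume "openin (prod_topology Y X) U"
  then have "openin (prod_topology X Y) (U\<inverse>)" by (rule openin_prod_converse)
  then have "openin X (fst ` (A \<inter> U\<inverse>)) \<and> openin Y (snd ` (A \<inter> U\<inverse>))"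
    using assms unfolding locally_open_projections_def by blast
  moreover have "fst ` (A\<inverse> \<inter> U) = snd ` (A \<inter> U\<inverse>)" "snd ` (A\<inverse> \<inter> U) = fst ` (A \<inter> U\<inverse>)"
    by force+
  ultimately show "openin Y (fst ` (A\<inverse> \<inter> U)) \<and> openin X (snd ` (A\<inverse> \<inter> U))" by simp
qed

lemma box_converse: "box Y X (A\<inverse>) c \<longleftrightarrow> box X Y A (prod.swap c)"
  unfolding box_def by auto

theorem theorem1p13:
  fixes X :: "'a topology" and Y :: "'b topology" and A :: "('a \<times> 'b) set"
  assumes "polish_topology X" and "perfect_topology X" and "zero_dimensional_topology X"
    and "polish_topology Y" and "perfect_topology Y" and "zero_dimensional_topology Y"
    and "gdelta_in (prod_topology X Y) A" and "A \<noteq> {}"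
    and "locally_open_projections X Y A"
  shows "(\<exists>F G f. almost_open_in X F \<and> F \<noteq> {} \<and> almost_open_in Y G \<and> G \<noteq> {} \<and>
            continuous_open_surjection X F Y G f \<and>
            {(x, f x) |x. x \<in> F} \<subseteq> A) \<or>
         (\<exists>F G f. almost_open_in Y F \<and> F \<noteq> {} \<and> almost_open_in X G \<and> G \<noteq> {} \<and>
            continuous_open_surjection Y F X G f \<and>
            {(y, f y) |y. y \<in> F} \<subseteq> {(y, x). (x, y) \<in> A})"
proof -
  obtain MX dX where X: "Metric_space MX dX" "Metric_space.mcomplete MX dX" "X = Metric_space.mtopology MX dX"
    using assms(1) unfolding polish_topology_def completely_metrizable_space_def by blast
  obtain MY dY where Y: "Metric_space MY dY" "Metric_space.mcomplete MY dY" "Y = Metric_space.mtopology MY dY"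
    using assms(4) unfolding polish_topology_def completely_metrizable_space_def by blast
  have sep: "separable_space X" "separable_space Y"
    using assms(1,4) unfolding polish_topology_def by auto
  interpret XY: complete_separable_pair MX dX MY dY
    using X Y sep by (simp add: complete_separable_pair_def complete_separable_pair_axioms_def)
  interpret YX: complete_separable_pair MY dY MX dX
    using X Y sep by (simp add: complete_separable_pair_def complete_separable_pair_axioms_def)
  obtain D :: "nat \<Rightarrow> _" where D: "\<And>n. openin (prod_topology X Y) (D n)" "\<Inter>(range D) = A"
    using assms(7) unfolding gdelta_in_descending by blast
  have AD: "A \<subseteq> D n" for n using D(2) by blast
  \<comment> \<open>If every box contains a tight one, the tight boxes form a refinable class and
    the map goes from \<open>X\<close> to \<open>Y\<close>; otherwise the boxes inside a box without
    tight subboxes do, after exchanging the factors.\<close>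
  show ?thesis
  proof (cases "\<forall>b. box X Y A b \<longrightarrow>
      (\<exists>c. box X Y A c \<and> tight X Y A c \<and> fst c \<subseteq> fst b \<and> snd c \<subseteq> snd b)")
    case True
    obtain x y where xy: "(x, y) \<in> A" using assms(8) by auto
    have "A \<subseteq> topspace (prod_topology X Y)" using assms(7) gdelta_in_subset by blast
    then have "x \<in> topspace X" "y \<in> topspace Y" using xy by auto
    then obtain b where "box X Y A b"
      using XY.small_box_at_point[of A D 0 "topspace X" "topspace Y" x y] assms(9) D(1) AD xy
      unfolding X(3) Y(3) by (metis openin_topspace)
    then obtain b0 where b0: "b0 \<in> {c. box X Y A c \<and> tight X Y A c}" using True by blast
    have "\<exists>F G f. almost_open_in X F \<and> F \<noteq> {} \<and> almost_open_in Y G \<and> G \<noteq> {} \<and>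
        continuous_open_surjection X F Y G f \<and> {(x, f x) |x. x \<in> F} \<subseteq> \<Inter>(range D)"
      unfolding X(3) Y(3)
    proof (rule XY.open_surjection_from_refining_families[OF b0[unfolded X(3) Y(3)]])
      fix b n assume "b \<in> {c. box XY.X XY.Y A c \<and> tight XY.X XY.Y A c}"
      then show "\<exists>C\<subseteq>{c. box XY.X XY.Y A c \<and> tight XY.X XY.Y A c}. XY.refining_family D n b C"
        using XY.tight_refining_family[of A D b n] assms(9) D(1) AD True unfolding X(3) Y(3) by blast
    qed (simp add: box_def)
    then show ?thesis unfolding D(2) by blast
  next
    case False
    then obtain b where b: "box X Y A b"
      and none: "\<And>c. box X Y A c \<Longrightarrow> fst c \<subseteq> fst b \<Longrightarrow> snd c \<subseteq> snd b \<Longrightarrow> \<not> tight X Y A c"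
      by blast
    let ?D = "\<lambda>n. (D n)\<inverse>"
    let ?B = "{c. box Y X (A\<inverse>) c \<and> fst c \<subseteq> snd b \<and> snd c \<subseteq> fst b}"
    have lop': "locally_open_projections Y X (A\<inverse>)"
      using assms(9) by (rule locally_open_projections_converse)
    have D': "openin (prod_topology Y X) (?D n)" "A\<inverse> \<subseteq> ?D n" for n
      using openin_prod_converse[OF D(1)] AD by auto
    have b0: "prod.swap b \<in> ?B" using b by (simp add: box_converse)
    have "\<exists>F G f. almost_open_in Y F \<and> F \<noteq> {} \<and> almost_open_in X G \<and> G \<noteq> {} \<and>
        continuous_open_surjection Y F X G f \<and> {(x, f x) |x. x \<in> F} \<subseteq> \<Inter>(range ?D)"
      unfolding X(3) Y(3)
    proof (rule YX.open_surjection_from_refining_families[OF b0[unfolded X(3) Y(3)]], fold X(3) Y(3))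
      fix d n assume d: "d \<in> ?B"
      \<comment> \<open>Over \<open>(Y, X)\<close> the relation is \<open>A\<inverse>\<close>, so
        the swapped tightness excluded in the nowhere tight case is tightness for \<open>A\<close>
        itself. Its absence is inherited by all boxes inside the swapped \<open>b\<close>.\<close>
      have "\<exists>C\<subseteq>{c. box Y X (A\<inverse>) c \<and> fst c \<subseteq> fst d \<and> snd c \<subseteq> snd d}. YX.refining_family ?D n d C"
        unfolding X(3) Y(3)
      proof (rule YX.nowhere_tight_refining_family, fold X(3) Y(3))
        show "\<not> tight X Y ((A\<inverse>)\<inverse>) (prod.swap c)"
          if "box Y X (A\<inverse>) c" "fst c \<subseteq> fst d" "snd c \<subseteq> snd d" for c
          using none[of "prod.swap c"] that d by (auto simp: box_converse)
        show "locally_open_projections Y X (A\<inverse>)" by (rule lop')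
        show "openin (prod_topology Y X) (?D n)" "A\<inverse> \<subseteq> ?D n" for n by (rule D')+
        show "box Y X (A\<inverse>) d" using d by simp
      qed
      then obtain C where C: "C \<subseteq> {c. box Y X (A\<inverse>) c \<and> fst c \<subseteq> fst d \<and> snd c \<subseteq> snd d}"
        and "YX.refining_family ?D n d C" by (elim exE conjE)
      moreover have "C \<subseteq> ?B"
      proof
        fix c assume "c \<in> C"
        with C have "box Y X (A\<inverse>) c" "fst c \<subseteq> fst d" "snd c \<subseteq> snd d" by auto
        with d show "c \<in> ?B" by auto
      qed
      ultimately show "\<exists>C\<subseteq>?B. YX.refining_family ?D n d C" by (intro exI[of _ C] conjI)
    qed (simp add: box_def)
    moreover have "\<Inter>(range ?D) = {(y, x). (x, y) \<in> A}" using D(2) by auto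
    ultimately show ?thesis by simp
  qed
qed

end
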